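(* Let $G=(V_1,V_2,E)$ be a finite directed bipartite graph with all arcs directed from $V_1$ (senders) to $V_2$ (receivers). Let $k\ge1$, and let $V_1$ be partitioned into groups $L_1,\ldots,L_k$, each $L_l$ consisting of exactly one influencer (the $l$th influencer) and $r_l\ge0$ subordinates. Assume: (A1') The receivers are partitioned as $V_2=G_0\cup G_1\cup\cdots\cup G_k$ (with $G_1,\dots,G_k$ nonempty and $G_0$ possibly empty). For $l=1,\ldots,k$, the $l$th influencer is adjacent to all receivers of $G_l$. Receivers in $G_0$ are not adjacent to any influencer. (A2') For each $l=1,\ldots,k$ there exists $H_l\subset G_l$ (not necessarily proper) such that receivers in $H_l$ are adjacent only to senders from group $L_l$; write $n_l=|G_l|$ and $|H_l|=\theta_l n_l$ with $0<\theta_l\le1$. (A3') For each $l=1,\ldots,k$, each subordinate in $L_l$ is adjacent to at most $\beta_l\theta_l n_l$ receivers of $H_l$, where $0<\beta_l<1$. Let $\rho=\min_l\theta_l/\max_l\theta_l$ and $n_{\min}=\min(n_1,\ldots,n_k)$, and for a subordinate $i$ let $z_i$ denote the number of nodes of $G_0$ adjacent to $i$. Suppose that $$\beta_l<\rho/2\quad\text{for all } l=1,\ldots,k,$$ and $$z_i\le n_{\min}\theta_l\rho/2\quad\text{for all subordinates } i\in L_l,\ l=1,\ldots,k.$$ Let $A$ be the $|V_1|\times|V_2|$ matrix whose $(i,j)$ entry is $1$ if $(i,j)\in E$ and $0$ otherwise. Then the unique optimal solution of the linear program $$\max_{\mathbf{x}\in\mathbb{R}^{|V_1|},\,\mathbf{t}\in\mathbb{R}^{|V_2|}}\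 \mathbf{e}^T\mathbf{t}\quad\text{s.t.}\quad \mathbf{t}\le A^T\mathbf{x},\quad \mathbf{0}\le\mathbf{t}\le\mathbf{e},\quad \mathbf{e}^T\mathbf{x}=k,\quad \mathbf{0}\le\mathbf{x}\le\mathbf{e}$$ is $(\mathbf{x}^*,\mathbf{t}^* )$, where $x^*_i=1$ if $i$ is an influencer and $x^*_i=0$ otherwise, and $t^*_j=1$ if $j\in G_1\cup\cdots\cup G_k$ and $t^*_j=0$ if $j\in G_0$.
   Context: $\mathbf{e}$ denotes the all-ones vector and $\mathbf{0}$ the zero vector, of appropriate dimension; vector inequalities are entrywise. "Influencer" and "subordinate" are just names for the designated node, respectively the other nodes, of each sender group $L_l$. A sender $i$ and a receiver $j$ are adjacent if $(i,j)\in E$. *)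

theory Defs
  imports "HOL-Analysis.Analysis"
begin

text \<open>
  Senders and receivers are the elements of two finite types, so that a finite bipartite graph with
  all arcs directed from senders to receivers is a set \<open>E\<close> of (sender, receiver) pairs. On
  \<open>real ^ 'n\<close>, \<open>1\<close> is the all-ones vector and \<open>\<le>\<close> is the entrywise order.
\<close>

definition adj_matrix :: "('s::finite \<times> 'r::finite) set \<Rightarrow> real ^ 'r ^ 's" where
  "adj_matrix E = (\<chi> i j. if (i, j) \<in> E then 1 else 0)"

definition lp_feasible ::
    "real ^ 'r ^ 's \<Rightarrow> nat \<Rightarrow> (real ^ 's::finite) \<times> (real ^ 'r::finite) \<Rightarrow> bool" where
  "lp_feasible A k = (\<lambda>(x, t).
     t \<le> transpose A *v x \<and> 0 \<le> t \<and> t \<le> 1 \<and> 1 \<bullet> x = real k \<and> 0 \<le> x \<and> x \<le> 1)"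

definition lp_optimal ::
    "real ^ 'r ^ 's \<Rightarrow> nat \<Rightarrow> (real ^ 's::finite) \<times> (real ^ 'r::finite) \<Rightarrow> bool" where
  "lp_optimal A k p \<longleftrightarrow>
     lp_feasible A k p \<and> (\<forall>q. lp_feasible A k q \<longrightarrow> 1 \<bullet> snd q \<le> 1 \<bullet> snd p)"

end

theory Submission
  imports Defs
begin

text \<open>
  An LP duality certificate. Give weight 1 to every receiver of \<open>G 0\<close> and weight
  \<open>\<mu> / card (H l)\<close> to every receiver of \<open>H l\<close>, where
  \<open>\<mu> = n_min * Min (\<theta> ` {1..k})\<close> is small enough to keep the weights below 1. Each influencer
  then sees total weight exactly \<open>\<mu>\<close>, while each subordinate of \<open>L l\<close> sees at most
  \<open>\<beta> l * \<mu> + n_min * \<theta> l * \<rho> / 2 < \<mu>\<close>. Weak duality bounds the objective by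
  \<open>\<Sum>l. n l\<close>, and strict complementarity forces \<open>x\<close> to vanish on all subordinates.
\<close>

lemma inner_one_vec: "(1::real^'n) \<bullet> x = (\<Sum>i\<in>UNIV. x $ i)"
  by (simp add: inner_vec_def)

lemma sum_indicator_UNIV: "(\<Sum>j\<in>UNIV. indicator S j) = real (card (S :: 'a::finite set))"
  by (simp add: indicator_def sum.If_cases)

text \<open>Here \<open>w\<close> prices the constraint \<open>t \<le> transpose A *v x\<close> and
  \<open>1 - w\<close> prices \<open>t \<le> 1\<close>. Split each \<open>t $ j\<close> in
  proportions \<open>1 - w $ j\<close> and \<open>w $ j\<close> and bound each share by its own
  constraint; moving \<open>A\<close> across the inner product leaves the weight that each sender
  sees.\<close>

lemma lp_weak_duality:
  fixes A :: "real ^ 'r::finite ^ 's::finite" and w :: "real ^ 'r"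
  assumes feas: "lp_feasible A k (x, t)" and w: "0 \<le> w" "w \<le> 1"
  shows "1 \<bullet> t \<le> 1 \<bullet> (1 - w) + (A *v w) \<bullet> x"
proof -
  have t: "t $ j \<le> (transpose A *v x) $ j" "t $ j \<le> 1" for j
    using feas by (auto simp: lp_feasible_def less_eq_vec_def)
  have w': "0 \<le> w $ j" "w $ j \<le> 1" for j
    using w by (auto simp: less_eq_vec_def)
  have "1 \<bullet> t = (\<Sum>j\<in>UNIV. (1 - w $ j) * t $ j + w $ j * t $ j)"
    by (simp add: inner_one_vec algebra_simps)
  also have "\<dots> \<le> (\<Sum>j\<in>UNIV. (1 - w $ j) * 1 + w $ j * (transpose A *v x) $ j)"
    by (intro sum_mono add_mono mult_left_mono t) (simp_all add: w')
  also have "\<dots> = 1 \<bullet> (1 - w) + w \<bullet> (transpose A *v x)"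
    by (simp add: inner_one_vec sum.distrib inner_vec_def[of w])
  also have "w \<bullet> (transpose A *v x) = (A *v w) \<bullet> x"
    using dot_lmul_matrix[of x A w] by (simp add: inner_commute)
  finally show ?thesis .
qed

text \<open>Evaluates the weight seen by sender \<open>i\<close> for a combination of indicators,
  the shape of the dual weights. An adjacency row times the indicator of \<open>S\<close> is the
  indicator of the neighbours of \<open>i\<close> in \<open>S\<close>, so each term becomes a
  count.\<close>

lemma adj_matrix_mult_indicators:
  fixes E :: "('s::finite \<times> 'r::finite) set" and \<omega> :: "nat \<Rightarrow> real"
  shows "(adj_matrix E *v (\<chi> j. indicator B j + (\<Sum>l\<in>I. \<omega> l * indicator (H l) j))) $ i =
    real (card {j \<in> B. (i, j) \<in> E}) + (\<Sum>l\<in>I. \<omega> l * real (card {j \<in> H l. (i, j) \<in> E}))"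
proof -
  have card: "(\<Sum>j\<in>UNIV. (if (i, j) \<in> E then 1 else 0) * indicator S j) = real (card {j \<in> S. (i, j) \<in> E})"
    for S :: "'r set"
  proof -
    have "(\<Sum>j\<in>UNIV. (if (i, j) \<in> E then 1 else 0) * indicator S j)
        = (\<Sum>j\<in>UNIV. indicator {j \<in> S. (i, j) \<in> E} j :: real)"
      by (intro sum.cong) (auto simp: indicator_def)
    also have "\<dots> = real (card {j \<in> S. (i, j) \<in> E})"
      by (rule sum_indicator_UNIV)
    finally show ?thesis .
  qed
  have "(adj_matrix E *v (\<chi> j. indicator B j + (\<Sum>l\<in>I. \<omega> l * indicator (H l) j))) $ i =
    (\<Sum>j\<in>UNIV. (if (i, j) \<in> E then 1 else 0) * indicator B j
      + (\<Sum>l\<in>I. \<omega> l * ((if (i, j) \<in> E then 1 else 0) * indicator (H l) j)))"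
    by (auto simp: adj_matrix_def matrix_vector_mult_def intro!: sum.cong)
  also have "\<dots> = (\<Sum>j\<in>UNIV. (if (i, j) \<in> E then 1 else 0) * indicator B j)
      + (\<Sum>l\<in>I. \<omega> l * (\<Sum>j\<in>UNIV. (if (i, j) \<in> E then 1 else 0) * indicator (H l) j))"
    unfolding sum.distrib sum_distrib_left by (subst (2) sum.swap) simp
  finally show ?thesis unfolding card .
qed

theorem theorem2:
  fixes E :: "('s::finite \<times> 'r::finite) set"
    and k :: nat
    and L :: "nat \<Rightarrow> 's set" and infl :: "nat \<Rightarrow> 's"
    and G H :: "nat \<Rightarrow> 'r set"
    and n :: "nat \<Rightarrow> nat" and \<theta> \<beta> :: "nat \<Rightarrow> real" and \<rho> :: real and n_min :: nat
  assumes k: "k \<ge> 1"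
    and L_disjoint: "disjoint_family_on L {1..k}"
    and L_cover: "(\<Union>l\<in>{1..k}. L l) = UNIV"
    and infl: "\<forall>l\<in>{1..k}. infl l \<in> L l"
    and G_disjoint: "disjoint_family_on G {0..k}"
    and G_cover: "(\<Union>l\<in>{0..k}. G l) = UNIV"
    and G_nonempty: "\<forall>l\<in>{1..k}. G l \<noteq> {}"
    and infl_G: "\<forall>l\<in>{1..k}. \<forall>j\<in>G l. (infl l, j) \<in> E"
    and infl_G0: "\<forall>j\<in>G 0. \<forall>l\<in>{1..k}. (infl l, j) \<notin> E"
    and H_subset: "\<forall>l\<in>{1..k}. H l \<subseteq> G l"
    and H_only: "\<forall>l\<in>{1..k}. \<forall>j\<in>H l. \<forall>i. (i, j) \<in> E \<longrightarrow> i \<in> L l"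
    and n: "\<forall>l\<in>{1..k}. n l = card (G l)"
    and theta: "\<forall>l\<in>{1..k}. real (card (H l)) = \<theta> l * real (n l) \<and> 0 < \<theta> l \<and> \<theta> l \<le> 1"
    and beta: "\<forall>l\<in>{1..k}. 0 < \<beta> l \<and> \<beta> l < 1"
    and sub_H: "\<forall>l\<in>{1..k}. \<forall>i\<in>L l - {infl l}.
                  real (card {j \<in> H l. (i, j) \<in> E}) \<le> \<beta> l * \<theta> l * real (n l)"
    and rho: "\<rho> = Min (\<theta> ` {1..k}) / Max (\<theta> ` {1..k})"
    and n_min: "n_min = Min (n ` {1..k})"
    and beta_rho: "\<forall>l\<in>{1..k}. \<beta> l < \<rho> / 2"
    and z_bound: "\<forall>l\<in>{1..k}. \<forall>i\<in>L l - {infl l}.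
                    real (card {j \<in> G 0. (i, j) \<in> E}) \<le> real n_min * \<theta> l * \<rho> / 2"
  shows "{p. lp_optimal (adj_matrix E) k p} =
           {(\<chi> i. if i \<in> infl ` {1..k} then 1 else 0,
             \<chi> j. if j \<in> (\<Union>l\<in>{1..k}. G l) then 1 else 0)}"
proof -

  \<comment> \<open>Candidate optimum and dual weights\<close>
  define I where "I = {1..k}"
  define A where "A = adj_matrix E"
  define xs :: "real ^ 's" where "xs = (\<chi> i. if i \<in> infl ` I then 1 else 0)"
  define ts :: "real ^ 'r" where "ts = (\<chi> j. if j \<in> (\<Union>l\<in>I. G l) then 1 else 0)"
  define N where "N = (\<Sum>l\<in>I. real (n l))"
  \<comment> \<open>\<open>\<mu>\<close> is also the dual multiplier of
    \<open>1 \<bullet> x = real k\<close>; the constraint \<open>x \<le> 1\<close> gets multiplier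
    zero.\<close>
  define \<mu> where "\<mu> = real n_min * Min (\<theta> ` I)"
  define \<omega> where "\<omega> l = \<mu> / real (card (H l))" for l
  define w :: "real ^ 'r" where "w = (\<chi> j. indicator (G 0) j + (\<Sum>l\<in>I. \<omega> l * indicator (H l) j))"

  \<comment> \<open>Signs and sizes of the constants; disjointness of the groups\<close>
  have fin: "finite I" "I \<noteq> {}" and cardI: "card I = k"
    using k by (auto simp: I_def)
  have n_pos: "0 < n l" if "l \<in> I" for l
    using n G_nonempty that by (auto simp: I_def card_gt_0_iff)
  have n_min_le: "n_min \<le> n l" and Min_le: "Min (\<theta> ` I) \<le> \<theta> l" and Max_ge: "\<theta> l \<le> Max (\<theta> ` I)"
    if "l \<in> I" for l
    using that fin by (auto simp: n_min[folded I_def])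
  have \<theta>_pos: "0 < \<theta> l" if "l \<in> I" for l using theta that by (auto simp: I_def)
  have Min_pos: "0 < Min (\<theta> ` I)" using fin \<theta>_pos by auto
  have n_min_pos: "0 < n_min" using fin n_pos by (auto simp: n_min[folded I_def])
  have \<mu>_pos: "0 < \<mu>" using Min_pos n_min_pos by (simp add: \<mu>_def)
  have cardH: "real (card (H l)) = \<theta> l * real (n l)" if "l \<in> I" for l
    using theta that by (auto simp: I_def)
  have \<mu>_le: "\<mu> \<le> real (card (H l))" if "l \<in> I" for l
  proof -
    have "\<mu> \<le> real (n l) * \<theta> l"
      unfolding \<mu>_def using n_min_le[OF that] Min_le[OF that] Min_pos by (intro mult_mono) auto
    then show ?thesis using cardH[OF that] by (simp add: mult.commute)
  qed
  have cardH_pos: "0 < real (card (H l))" if "l \<in> I" for l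
    using \<mu>_le[OF that] \<mu>_pos by linarith
  have \<omega>: "0 \<le> \<omega> l" "\<omega> l \<le> 1" "\<omega> l * real (card (H l)) = \<mu>" if "l \<in> I" for l
    using \<mu>_le[OF that] cardH_pos[OF that] \<mu>_pos by (auto simp: \<omega>_def)
  have Max_pos: "0 < Max (\<theta> ` I)"
    using fin \<theta>_pos Max_ge by (meson all_not_in_conv less_le_trans)
  have \<rho>_le: "\<rho> \<le> 1" and \<rho>_pos: "0 < \<rho>"
    using fin Min_pos Max_pos Min_le Max_ge
    by (auto simp: rho[folded I_def] divide_le_eq_1)
  \<comment> \<open>The ratio \<open>\<rho>\<close> trades the group's own \<open>\<theta> l\<close>
    for the minimum occurring in \<open>\<mu>\<close>, so the bound on neighbours in
    \<open>G 0\<close> becomes \<open>\<mu> / 2\<close>.\<close>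
  have \<theta>\<rho>: "\<theta> l * \<rho> \<le> Min (\<theta> ` I)" if "l \<in> I" for l
  proof -
    have "\<theta> l * \<rho> \<le> Max (\<theta> ` I) * \<rho>" using Max_ge[OF that] \<rho>_pos by simp
    also have "\<dots> = Min (\<theta> ` I)" using Max_pos by (simp add: rho[folded I_def])
    finally show ?thesis .
  qed
  have L_eq: "l = m" if "i \<in> L l" "i \<in> L m" "l \<in> I" "m \<in> I" for i l m
    using L_disjoint that unfolding disjoint_family_on_def I_def by blast
  have G_eq: "l = m" if "j \<in> G l" "j \<in> G m" "l \<in> {0..k}" "m \<in> {0..k}" for j l m
    using G_disjoint that unfolding disjoint_family_on_def by blast
  have inj: "inj_on infl I"
    using infl L_eq unfolding inj_on_def I_def by metis
  have I0: "I \<subseteq> {0..k}" "0 \<notin> I" by (auto simp: I_def)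

  \<comment> \<open>Weight seen by influencers and by subordinates\<close>
  have Aw: "(A *v w) $ i = real (card {j \<in> G 0. (i, j) \<in> E}) + \<omega> l * real (card {j \<in> H l. (i, j) \<in> E})"
    if l: "l \<in> I" and i: "i \<in> L l" for i l
  proof -
    \<comment> \<open>Receivers of \<open>H m\<close> hear only group \<open>L m\<close>, so a
      sender of \<open>L l\<close> picks up no weight from foreign groups.\<close>
    have other: "card {j \<in> H m. (i, j) \<in> E} = 0" if "m \<in> I - {l}" for m
    proof -
      have "{j \<in> H m. (i, j) \<in> E} = {}"
        using H_only L_eq[OF i _ l] that by (fastforce simp: I_def)
      then show ?thesis by (simp only: card.empty)
    qed
    show ?thesis
      unfolding A_def w_def adj_matrix_mult_indicators
      by (simp add: sum.remove[OF fin(1) l] other)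
  qed
  have Aw_infl: "(A *v w) $ infl l = \<mu>" if l: "l \<in> I" for l
  proof -
    have "{j \<in> H l. (infl l, j) \<in> E} = H l" "{j \<in> G 0. (infl l, j) \<in> E} = {}"
      using infl_G infl_G0 H_subset l unfolding I_def by blast+
    moreover have "infl l \<in> L l" using infl l by (simp add: I_def)
    ultimately show ?thesis using Aw[OF l] \<omega>(3)[OF l] by simp
  qed
  \<comment> \<open>The two contributions are each at most \<open>\<mu> / 2\<close>. The one from
    \<open>H l\<close> is strictly smaller, since \<open>\<beta> l < \<rho> / 2 \<le> 1 / 2\<close>;
    this strictness is what later gives uniqueness.\<close>
  have Aw_sub: "(A *v w) $ i < \<mu>" if i: "i \<notin> infl ` I" for i
  proof -
    obtain l where l: "l \<in> I" "i \<in> L l" using L_cover unfolding I_def by blast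
    have sub: "i \<in> L l - {infl l}" using i l by auto
    have "\<omega> l * real (card {j \<in> H l. (i, j) \<in> E}) \<le> \<omega> l * (\<beta> l * real (card (H l)))"
      using sub_H sub l(1) cardH[OF l(1)] \<omega>(1)[OF l(1)]
      by (intro mult_left_mono) (auto simp: I_def mult.assoc)
    also have "\<dots> = \<beta> l * \<mu>" using \<omega>(3)[OF l(1)] by (metis mult.left_commute)
    also have "\<dots> < \<mu> / 2"
    proof -
      have "\<beta> l < 1 / 2" using beta_rho \<rho>_le l(1) by (force simp: I_def)
      then show ?thesis using \<mu>_pos by (simp add: field_simps)
    qed
    moreover have "real (card {j \<in> G 0. (i, j) \<in> E}) \<le> \<mu> / 2"
    proof -
      have "real (card {j \<in> G 0. (i, j) \<in> E}) \<le> real n_min * (\<theta> l * \<rho>) / 2"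
        using z_bound sub l(1) by (auto simp: I_def mult.assoc)
      also have "\<dots> \<le> \<mu> / 2"
        unfolding \<mu>_def using \<theta>\<rho>[OF l(1)] by (simp add: mult_left_mono)
      finally show ?thesis .
    qed
    ultimately show ?thesis using Aw[OF l] by linarith
  qed
  have Aw_le: "(A *v w) $ i \<le> \<mu>" for i
    using Aw_infl Aw_sub[of i] by force

  \<comment> \<open>Feasibility and value of the dual weights\<close>
  have w_bounds: "0 \<le> w" "w \<le> 1"
  proof -
    show "0 \<le> w"
      using \<omega>(1) by (auto simp: less_eq_vec_def w_def intro!: add_nonneg_nonneg sum_nonneg mult_nonneg_nonneg)
    have "w $ j \<le> 1" for j
    proof -
      \<comment> \<open>The sets \<open>G m\<close> are disjoint and contain the \<open>H m\<close>,
        so at most one term of \<open>w $ j\<close> is nonzero: 1 on \<open>G 0\<close>,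
        \<open>\<omega> m\<close> on \<open>H m\<close>.\<close>
      obtain m where m: "m \<in> {0..k}" "j \<in> G m" using G_cover by blast
      have out: "j \<notin> H l" if "l \<in> I" "l \<noteq> m" for l
        using H_subset[folded I_def] G_eq[OF m(2) _ m(1)] that I0 by blast
      show ?thesis
      proof (cases "m = 0")
        case True
        then have "j \<notin> H l" if "l \<in> I" for l
          using out that I0 by metis
        then have "(\<Sum>l\<in>I. \<omega> l * indicator (H l) j) = 0"
          by (intro sum.neutral) simp
        then show ?thesis using m True by (simp add: w_def)
      next
        case False
        then have mI: "m \<in> I" and "j \<notin> G 0"
          using m G_eq[of j m 0] by (auto simp: I_def)
        then show ?thesis
          using \<omega>(1,2)[OF mI] out
          by (simp add: w_def sum.remove[OF fin(1) mI] indicator_def)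
      qed
    qed
    then show "w \<le> 1" by (simp add: less_eq_vec_def)
  qed
  have cardU: "real (card (\<Union>l\<in>I. G l)) = N"
  proof -
    have "card (\<Union>l\<in>I. G l) = (\<Sum>l\<in>I. card (G l))"
    proof (intro card_UN_disjoint ballI impI)
      show "G l \<inter> G m = {}" if "l \<in> I" "m \<in> I" "l \<noteq> m" for l m
        using G_eq[of _ l m] that I0(1) by blast
    qed (use fin in auto)
    then show ?thesis using n by (simp add: N_def I_def)
  qed
  have G0_compl: "G 0 = - (\<Union>l\<in>I. G l)"
  proof -
    have "{0..k} = insert 0 I" by (auto simp: I_def)
    then have "G 0 \<union> (\<Union>l\<in>I. G l) = UNIV" using G_cover by simp
    moreover have "G 0 \<inter> (\<Union>l\<in>I. G l) = {}"
    proof (intro equals0I)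
      fix j assume "j \<in> G 0 \<inter> (\<Union>l\<in>I. G l)"
      then obtain l where "l \<in> I" "j \<in> G l" "j \<in> G 0" by blast
      then show False using G_eq[of j l 0] I0 by auto
    qed
    ultimately show ?thesis by blast
  qed
  \<comment> \<open>Total weight is \<open>card (G 0)\<close> plus \<open>\<mu>\<close> for each of
    the \<open>k\<close> groups. The term \<open>real k * \<mu>\<close> will cancel against the
    multiplier of \<open>1 \<bullet> x = real k\<close>.\<close>
  have w_value: "1 \<bullet> (1 - w) = N - real k * \<mu>"
  proof -
    have "(\<Sum>j\<in>UNIV. \<Sum>l\<in>I. \<omega> l * indicator (H l) j) = (\<Sum>l\<in>I. \<omega> l * real (card (H l)))"
      by (subst sum.swap) (simp add: sum_indicator_UNIV flip: sum_distrib_left)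
    also have "\<dots> = real k * \<mu>" using \<omega>(3) cardI by simp
    moreover have "real CARD('r) - real (card (G 0)) = N"
      unfolding G0_compl cardU[symmetric]
      by (simp add: Compl_eq_Diff_UNIV card_Diff_subset of_nat_diff card_mono)
    ultimately show ?thesis
      by (simp add: inner_one_vec w_def sum_subtractf sum.distrib sum_indicator_UNIV)
  qed

  \<comment> \<open>Feasibility and value of the candidate\<close>
  have ts_value: "1 \<bullet> ts = N"
  proof -
    have "ts $ j = indicator (\<Union>l\<in>I. G l) j" for j by (simp add: ts_def indicator_def)
    then show ?thesis using cardU by (simp add: inner_one_vec sum_indicator_UNIV)
  qed
  have feas: "lp_feasible A k (xs, ts)"
  proof -
    have "ts $ j \<le> (transpose A *v xs) $ j" for j
    proof -
      have eq: "(transpose A *v xs) $ j = (\<Sum>i\<in>UNIV. (if (i, j) \<in> E \<and> i \<in> infl ` I then 1 else 0))"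
        by (auto simp: A_def adj_matrix_def xs_def transpose_def matrix_vector_mult_def intro!: sum.cong)
      show ?thesis
      proof (cases "j \<in> (\<Union>l\<in>I. G l)")
        case True
        then obtain l where l: "l \<in> I" "(infl l, j) \<in> E" using infl_G by (auto simp: I_def)
        \<comment> \<open>The influencer of the group containing \<open>j\<close> alone contributes
          1, and the other summands are nonnegative.\<close>
        have "1 \<le> (transpose A *v xs) $ j"
          unfolding eq using l by (intro order_trans[OF _ member_le_sum[of "infl l"]]) auto
        then show ?thesis by (simp add: ts_def True)
      next
        case False
        then show ?thesis unfolding eq by (auto simp: ts_def intro!: sum_nonneg)
      qed
    qed
    moreover have "1 \<bullet> xs = real k"
    proof -
      have "xs $ i = indicator (infl ` I) i" for i by (simp add: xs_def indicator_def)
      then show ?thesis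
        using card_image[OF inj] cardI by (simp add: inner_one_vec sum_indicator_UNIV)
    qed
    ultimately show ?thesis
      by (auto simp: lp_feasible_def less_eq_vec_def xs_def ts_def)
  qed

  \<comment> \<open>Duality gap, complementary slackness and uniqueness\<close>
  have bound: "1 \<bullet> t + (\<Sum>i\<in>UNIV. (\<mu> - (A *v w) $ i) * x $ i) \<le> N"
    if f: "lp_feasible A k (x, t)" for x t
  proof -
    \<comment> \<open>The slack sum is exactly what is lost when \<open>(A *v w) \<bullet> x\<close>
      is replaced by \<open>\<mu> * (1 \<bullet> x)\<close>. Keeping it in the bound makes the
      equality case readable.\<close>
    have "(\<Sum>i\<in>UNIV. (\<mu> - (A *v w) $ i) * x $ i) = \<mu> * (1 \<bullet> x) - (A *v w) \<bullet> x"
      by (simp add: inner_one_vec inner_vec_def[of _ x] left_diff_distrib sum_subtractf sum_distrib_left)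
    moreover have "1 \<bullet> x = real k" using f by (simp add: lp_feasible_def)
    ultimately show ?thesis
      using lp_weak_duality[OF f w_bounds] w_value by (simp add: mult.commute)
  qed
  have slack_nonneg: "0 \<le> (\<mu> - (A *v w) $ i) * x $ i" if "lp_feasible A k (x, t)" for x t i
    proof (rule mult_nonneg_nonneg)
    show "0 \<le> \<mu> - (A *v w) $ i" using Aw_le by simp
    show "0 \<le> x $ i" using that by (simp add: lp_feasible_def less_eq_vec_def)
  qed
  have slack_sum_nonneg: "0 \<le> (\<Sum>i\<in>UNIV. (\<mu> - (A *v w) $ i) * x $ i)" if "lp_feasible A k (x, t)" for x t
    by (intro sum_nonneg slack_nonneg[OF that])
  have le: "1 \<bullet> t \<le> N" if f: "lp_feasible A k (x, t)" for x t
    using bound[OF f] slack_sum_nonneg[OF f] by linarith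
  have uniq: "x = xs \<and> t = ts" if f: "lp_feasible A k (x, t)" and opt: "1 \<bullet> t = N" for x t
  proof -
    have x: "0 \<le> x $ i" "x $ i \<le> 1" and t: "0 \<le> t $ j" "t $ j \<le> 1" "t $ j \<le> (transpose A *v x) $ j"
      for i j
      using f by (auto simp: lp_feasible_def less_eq_vec_def)
    \<comment> \<open>At value \<open>N\<close> no gap is left, so each nonnegative slack term
      vanishes; for a subordinate the factor \<open>\<mu> - (A *v w) $ i\<close> is positive,
      forcing \<open>x $ i = 0\<close>.\<close>
    have "(\<Sum>i\<in>UNIV. (\<mu> - (A *v w) $ i) * x $ i) = 0"
      using bound[OF f] opt slack_sum_nonneg[OF f] by linarith
    then have "(\<mu> - (A *v w) $ i) * x $ i = 0" for i
      using slack_nonneg[OF f] by (simp add: sum_nonneg_eq_0_iff)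
    then have x0: "x $ i = 0" if "i \<notin> infl ` I" for i
      using Aw_sub[OF that] by (metis diff_gt_0_iff_gt less_numeral_extra(3) mult_eq_0_iff)
    have x_le: "x $ i \<le> xs $ i" for i
      using x x0 by (simp add: xs_def)
    \<comment> \<open>Both vectors sum to \<open>k\<close> and \<open>x\<close> lies entrywise below
      \<open>xs\<close>, so they agree. The same comparison, with sum \<open>N\<close>, settles
      \<open>t\<close> below.\<close>
    have "(\<Sum>i\<in>UNIV. xs $ i - x $ i) = 0"
      using f feas by (simp add: lp_feasible_def inner_one_vec sum_subtractf)
    then have "x $ i = xs $ i" for i
      using x_le by (simp add: sum_nonneg_eq_0_iff)
    then have x_eq: "x = xs" by (simp add: vec_eq_iff)
    have t_le: "t $ j \<le> ts $ j" for j
    proof (cases "j \<in> G 0")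
      case True
      \<comment> \<open>No influencer reaches \<open>G 0\<close>, so once \<open>x = xs\<close> the
        receivers there are forced to 0.\<close>
      have "(transpose A *v xs) $ j = 0"
        using infl_G0 True
        by (auto simp: A_def adj_matrix_def xs_def transpose_def matrix_vector_mult_def I_def intro!: sum.neutral)
      then show ?thesis using t(3)[of j] x_eq True by (simp add: ts_def G0_compl)
    next
      case False
      then show ?thesis using t(2) by (simp add: ts_def G0_compl)
    qed
    have "(\<Sum>j\<in>UNIV. ts $ j - t $ j) = 0"
      using opt ts_value by (simp add: inner_one_vec sum_subtractf)
    then have "t $ j = ts $ j" for j
      using t_le by (simp add: sum_nonneg_eq_0_iff)
    then show ?thesis using x_eq by (simp add: vec_eq_iff)
  qed

  \<comment> \<open>Identification of the optimal set\<close>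
  have "lp_optimal A k p \<longleftrightarrow> p = (xs, ts)" for p
  proof
    assume opt: "lp_optimal A k p"
    obtain x t where p: "p = (x, t)" by (cases p)
    from opt feas have f: "lp_feasible A k (x, t)" and "1 \<bullet> ts \<le> 1 \<bullet> t"
      by (auto simp: lp_optimal_def p)
    then have "1 \<bullet> t = N"
      using le[OF f] ts_value by linarith
    from uniq[OF f this] show "p = (xs, ts)" unfolding p by blast
  next
    assume "p = (xs, ts)"
    moreover have "1 \<bullet> snd q \<le> 1 \<bullet> ts" if "lp_feasible A k q" for q
      using le[of "fst q" "snd q"] that unfolding ts_value by simp
    ultimately show "lp_optimal A k p"
      unfolding lp_optimal_def using feas by simp
  qed
  then show ?thesis
    by (auto simp: A_def xs_def ts_def I_def)
qed

end
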